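(* Let $\Bbbk$ be a field, let $n>1$, and let $R=\Bbbk\langle x_1,\dots,x_n\rangle$ be the free associative unital $\Bbbk$-algebra. Then every differential operator $\varphi\in D_{\Bbbk}(R)$ can be written, in a unique way, as a series $$\varphi=\lambda_a+\sum_{I,w}\alpha_{I,w}\,\partial_I^{w_I},$$ where $a\in R$, $I$ ranges over all finite nonempty sequences of elements of $\{1,\dots,n\}$, $w$ ranges over all words in $R$, and $\alpha_{I,w}\in\Bbbk$ are such that for each $I$ only finitely many $\alpha_{I,w}$ are nonzero; the series is understood pointwise (applied to any element of $R$, only finitely many terms are nonzero).
   Context: Differential operators (Lunts–Rosenberg): $\mathrm{Hom}_{\Bbbk}(R,R)$ is an $R$-bimodule via $(r\varphi)(s)=r\varphi(s)$ and $(\varphi r)(s)=\varphi(rs)$. For $r\in R$ put $[\varphi,r]=\varphi r-r\varphi$. Set $D^{-1}_{\Bbbk}(R)=0$ and, for $m\ge 0$, let $D^m_{\Bbbk}(R)$ be the $R$-subbimodule of $\mathrm{Hom}_{\Bbbk}(R,R)$ generated by all $\varphi$ such that $[\varphi,r]\in D^{m-1}_{\Bbbk}(R)$ for every $r\in R$. Then $D_{\Bbbk}(R)=\bigcup_{m\ge 0}D^m_{\Bbbk}(R)$. $\lambda_a$ denotes left multiplication $s\mapsto as$. A word is a (possibly empty) product of the variables $x_1,\dots,x_n$. Operators $\partial_I^J$: for $i\le n$, $a\in R$, $\partial_i^a$ is the $\Bbbk$-linear derivation of $R$ with $\partial_i^a(x_j)=\delta_{i,j}a$; for length-one sequences $\partial_{(i)}^{(a)}=\partial_i^a$.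 For $r\ge 2$, $I=(i_1,\dots,i_r)$ with $1\le i_j\le n$, and $J=(a_1,\dots,a_r)$ with $a_j\in R$, put $\widehat I=(i_2,\dots,i_r)$, $\widehat J=(a_2,\dots,a_r)$; $\partial_I^J$ is the unique $\Bbbk$-linear operator on $R$ with $[\partial_I^J,x_{i_1}]=a_1\partial_{\widehat I}^{\widehat J}$, $[\partial_I^J,x_l]=0$ for $l\ne i_1$, and $\partial_I^J(1)=0$. The operator $\partial_I^J$ vanishes on all words of length less than $r$. For $I=(i_1,\dots,i_r)$ and a word $w$, $w_I$ denotes the sequence $(1,\dots,1,w)$ of length $r$. *)

theory Defs
  imports Complex_Main "HOL-Library.Poly_Mapping" "HOL-Library.Cardinality"
begin

section \<open>The free associative algebra\<close>

text \<open>
  The free monoid on \<open>'x\<close> is realised by lists under concatenation. With this instance the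
  convolution product that \<open>Poly_Mapping\<close> puts on finitely supported functions
  \<open>'x list \<Rightarrow>\<^sub>0 'k\<close> makes this type the free associative unital \<open>'k\<close>-algebra on the
  variables \<open>X j\<close>, \<open>j :: 'x\<close>.
\<close>

instantiation list :: (type) monoid_add
begin

definition zero_list :: "'a list" where "zero_list = []"

definition plus_list :: "'a list \<Rightarrow> 'a list \<Rightarrow> 'a list" where "plus_list = (@)"

instance
  by standard (simp_all add: zero_list_def plus_list_def)

end

type_synonym ('x, 'k) free_alg = "'x list \<Rightarrow>\<^sub>0 'k"

definition word :: "'x list \<Rightarrow> ('x, 'k::field) free_alg"
  where "word w = Poly_Mapping.single w 1"

definition X :: "'x \<Rightarrow> ('x, 'k::field) free_alg"
  where "X j = word [j]"

definition scale :: "'k \<Rightarrow> ('x, 'k::field) free_alg \<Rightarrow> ('x, 'k) free_alg"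
  where "scale c p = Poly_Mapping.single 0 c * p"

lemma lookup_scale: "Poly_Mapping.lookup (scale c p) w = c * Poly_Mapping.lookup p w"
  unfolding scale_def mult_map_scale_conv_mult[symmetric] by (simp add: map.rep_eq when_def)

lemma vector_space_scale: "vector_space (scale :: 'k \<Rightarrow> ('x, 'k::field) free_alg \<Rightarrow> _)"
  by unfold_locales (auto intro!: poly_mapping_eqI simp: lookup_scale lookup_add algebra_simps)

section \<open>Differential operators\<close>

definition End_k :: "(('x, 'k::field) free_alg \<Rightarrow> ('x, 'k) free_alg) set"
  where "End_k = {\<phi>. Vector_Spaces.linear scale scale \<phi>}"

definition lmul :: "('x, 'k::field) free_alg \<Rightarrow> ('x, 'k) free_alg \<Rightarrow> ('x, 'k) free_alg"
  where "lmul a = (\<lambda>s. a * s)"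

definition left_act :: "('x, 'k::field) free_alg \<Rightarrow>
    (('x, 'k) free_alg \<Rightarrow> ('x, 'k) free_alg) \<Rightarrow> ('x, 'k) free_alg \<Rightarrow> ('x, 'k) free_alg"
  where "left_act r \<phi> = (\<lambda>s. r * \<phi> s)"

definition right_act :: "(('x, 'k::field) free_alg \<Rightarrow> ('x, 'k) free_alg) \<Rightarrow>
    ('x, 'k) free_alg \<Rightarrow> ('x, 'k) free_alg \<Rightarrow> ('x, 'k) free_alg"
  where "right_act \<phi> r = (\<lambda>s. \<phi> (r * s))"

definition comm :: "(('x, 'k::field) free_alg \<Rightarrow> ('x, 'k) free_alg) \<Rightarrow>
    ('x, 'k) free_alg \<Rightarrow> ('x, 'k) free_alg \<Rightarrow> ('x, 'k) free_alg"
  where "comm \<phi> r = (\<lambda>s. right_act \<phi> r s - left_act r \<phi> s)"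

text \<open>Closure under negation follows from closure under \<open>left_act (- 1)\<close>.\<close>

definition subbimodule :: "(('x, 'k::field) free_alg \<Rightarrow> ('x, 'k) free_alg) set \<Rightarrow> bool"
  where "subbimodule M \<longleftrightarrow> M \<subseteq> End_k \<and> (\<lambda>_. 0) \<in> M \<and>
    (\<forall>\<phi>\<in>M. \<forall>\<psi>\<in>M. (\<lambda>s. \<phi> s + \<psi> s) \<in> M) \<and>
    (\<forall>r. \<forall>\<phi>\<in>M. left_act r \<phi> \<in> M \<and> right_act \<phi> r \<in> M)"

text \<open>
  \<open>diff_ops m\<close> is the set of operators of order at most \<open>m\<close>; the convention that order
  \<open>-1\<close> gives the zero bimodule is built into the first equation.
\<close>

primrec diff_ops :: "nat \<Rightarrow> (('x, 'k::field) free_alg \<Rightarrow> ('x, 'k) free_alg) set"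
  where
    "diff_ops 0 = subbimodule hull {\<phi> \<in> End_k. \<forall>r. comm \<phi> r \<in> {\<lambda>_. 0}}"
  | "diff_ops (Suc m) = subbimodule hull {\<phi> \<in> End_k. \<forall>r. comm \<phi> r \<in> diff_ops m}"

definition Diff :: "(('x, 'k::field) free_alg \<Rightarrow> ('x, 'k) free_alg) set"
  where "Diff = (\<Union>m. diff_ops m)"

section \<open>The operators \<open>\<partial>\<^sub>I\<^sup>J\<close>\<close>

definition is_derivation :: "(('x, 'k::field) free_alg \<Rightarrow> ('x, 'k) free_alg) \<Rightarrow> bool"
  where "is_derivation d \<longleftrightarrow> d \<in> End_k \<and> (\<forall>p q. d (p * q) = d p * q + p * d q)"

definition partial_deriv :: "'x \<Rightarrow> ('x, 'k::field) free_alg \<Rightarrow>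
    ('x, 'k) free_alg \<Rightarrow> ('x, 'k) free_alg"
  where "partial_deriv i a =
    (THE d. is_derivation d \<and> (\<forall>j. d (X j) = (if i = j then a else 0)))"

text \<open>
  The two sequences are meant to be nonempty of equal length; the last equation is a junk value
  for all other arguments. \<open>ex1_partial_deriv\<close> and \<open>ex1_partial_op\<close> below show that the
  definite descriptions denote.
\<close>

fun partial_op :: "'x list \<Rightarrow> ('x, 'k::field) free_alg list \<Rightarrow>
    ('x, 'k) free_alg \<Rightarrow> ('x, 'k) free_alg"
  where
    "partial_op [i] [a] = partial_deriv i a"
  | "partial_op (i # i' # I) (a # a' # J) =
      (THE \<phi>. \<phi> \<in> End_k \<and>
        comm \<phi> (X i) = left_act a (partial_op (i' # I) (a' # J)) \<and>
        (\<forall>l. l \<noteq> i \<longrightarrow> comm \<phi> (X l) = (\<lambda>_. 0)) \<and>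
        \<phi> 1 = 0)"
  | "partial_op _ _ = (\<lambda>_. 0)"

definition word_seq :: "'x list \<Rightarrow> 'x list \<Rightarrow> ('x, 'k::field) free_alg list"
  where "word_seq w I = replicate (length I - 1) 1 @ [word w]"

section \<open>Existence and uniqueness of these operators\<close>

lemma End_k_iff: "\<phi> \<in> End_k \<longleftrightarrow>
    (\<forall>p q. \<phi> (p + q) = \<phi> p + \<phi> q) \<and> (\<forall>c p. \<phi> (scale c p) = scale c (\<phi> p))"
  using vector_space_scale
  by (auto simp: End_k_def Vector_Spaces.linear_iff_module_hom module_hom_iff module_iff_vector_space)

lemma scale_mult_left: "scale c p * q = scale c (p * q)"
  by (simp add: scale_def mult.assoc)

lemma scale_comm: "p * Poly_Mapping.single 0 c = Poly_Mapping.single 0 c * p"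
  for p :: "('x, 'k::field) free_alg"
proof (induction p rule: update_induct)
  case const
  show ?case by simp
next
  case (update f a b)
  then have "Poly_Mapping.update a b f = f + Poly_Mapping.single a b"
    by (auto intro!: poly_mapping_eqI
        simp: lookup_add lookup_update lookup_single when_def in_keys_iff)
  with update show ?case
    by (simp add: distrib_left distrib_right mult_single mult.commute)
qed

lemma scale_mult_right: "p * scale c q = scale c (p * q)"
  unfolding scale_def by (metis mult.assoc scale_comm)

lemma free_alg_induct [case_names zero step]:
  fixes p :: "('x, 'k::field) free_alg"
  assumes "P 0" "\<And>p c w. P p \<Longrightarrow> P (p + scale c (word w))"
  shows "P p"
proof (induction p rule: update_induct)
  case const
  show ?case by fact
next
  case (update f a b)
  then have "Poly_Mapping.update a b f = f + scale b (word a)"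
    by (auto intro!: poly_mapping_eqI simp: word_def scale_def mult_single
        lookup_add lookup_update lookup_single when_def in_keys_iff)
  with update assms show ?case by simp
qed

lemma End_k_zero: "\<phi> \<in> End_k \<Longrightarrow> \<phi> 0 = 0"
  unfolding End_k_iff by (metis add_cancel_right_right)

lemma End_k_ext:
  assumes "\<phi> \<in> End_k" "\<psi> \<in> End_k" "\<And>w. \<phi> (word w) = \<psi> (word w)"
  shows "\<phi> = \<psi>"
proof
  fix p show "\<phi> p = \<psi> p"
    using assms by (induction p rule: free_alg_induct) (auto simp: End_k_zero End_k_iff)
qed

lemma word_Nil: "word [] = 1"
  by (simp add: word_def flip: zero_list_def)

lemma word_Cons: "word (j # w) = X j * word w"
  by (simp add: word_def X_def mult_single plus_list_def)

definition lin_ext :: "('x list \<Rightarrow> ('x, 'k::field) free_alg) \<Rightarrow>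
    ('x, 'k) free_alg \<Rightarrow> ('x, 'k) free_alg"
  where "lin_ext T p = (\<Sum>w\<in>Poly_Mapping.keys p. scale (Poly_Mapping.lookup p w) (T w))"

lemma lin_ext_superset:
  assumes "finite A" "Poly_Mapping.keys p \<subseteq> A"
  shows "lin_ext T p = (\<Sum>w\<in>A. scale (Poly_Mapping.lookup p w) (T w))"
  unfolding lin_ext_def using assms
  by (intro sum.mono_neutral_left) (auto simp: in_keys_iff scale_def)

lemma lin_ext_End_k: "lin_ext T \<in> End_k"
  unfolding End_k_iff
proof (intro conjI allI)
  fix p q :: "('a, 'b) free_alg"
  have "Poly_Mapping.keys (p + q) \<subseteq> Poly_Mapping.keys p \<union> Poly_Mapping.keys q"
    by (rule keys_add)
  then show "lin_ext T (p + q) = lin_ext T p + lin_ext T q"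
    by (simp add: lin_ext_superset[of "Poly_Mapping.keys p \<union> Poly_Mapping.keys q"] lookup_add
        scale_def single_add distrib_right sum.distrib)
next
  fix c and p :: "('a, 'b) free_alg"
  have "Poly_Mapping.keys (scale c p) \<subseteq> Poly_Mapping.keys p"
    by (auto simp: in_keys_iff lookup_scale)
  then show "lin_ext T (scale c p) = scale c (lin_ext T p)"
    by (simp add: lin_ext_superset[of "Poly_Mapping.keys p"] lookup_scale)
       (simp add: scale_def sum_distrib_left mult_single flip: mult.assoc)
qed

lemma lin_ext_word: "lin_ext T (word w) = T w"
  by (simp add: lin_ext_def word_def scale_def)

text \<open>A linear operator is determined by its value at \<open>1\<close> and its commutators with the variables,
  and the latter are arbitrary.\<close>

lemma ex1_comm:
  assumes "\<And>j. \<psi> j \<in> End_k"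
  shows "\<exists>!\<phi>. \<phi> \<in> End_k \<and> (\<forall>j. comm \<phi> (X j) = \<psi> j) \<and> \<phi> 1 = 0"
proof (rule ex_ex1I)
  define T where "T = rec_list 0 (\<lambda>j w t. \<psi> j (word w) + X j * t)"
  have "comm (lin_ext T) (X j) = \<psi> j" for j
  proof (rule End_k_ext[OF _ assms])
    show "comm (lin_ext T) (X j) \<in> End_k"
      using lin_ext_End_k[of T]
      by (simp add: End_k_iff comm_def left_act_def right_act_def algebra_simps scale_mult_right)
         (simp add: scale_def algebra_simps)
    show "comm (lin_ext T) (X j) (word w) = \<psi> j (word w)" for w
      by (simp add: comm_def left_act_def right_act_def lin_ext_word T_def flip: word_Cons)
  qed
  moreover have "lin_ext T 1 = 0"
    by (simp add: lin_ext_word T_def flip: word_Nil)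
  ultimately show "\<exists>\<phi>. \<phi> \<in> End_k \<and> (\<forall>j. comm \<phi> (X j) = \<psi> j) \<and> \<phi> 1 = 0"
    using lin_ext_End_k by blast
next
  fix \<phi> \<phi>'
  assume *: "\<phi> \<in> End_k \<and> (\<forall>j. comm \<phi> (X j) = \<psi> j) \<and> \<phi> 1 = 0"
    and **: "\<phi>' \<in> End_k \<and> (\<forall>j. comm \<phi>' (X j) = \<psi> j) \<and> \<phi>' 1 = 0"
  have eq: "f (X j * s) = \<psi> j s + X j * f s"
    if "\<forall>j. comm f (X j) = \<psi> j" for f j s
    using fun_cong[OF that[rule_format], of j s]
    by (simp add: comm_def left_act_def right_act_def diff_eq_eq)
  have "\<phi> (word w) = \<phi>' (word w)" for w
    by (induction w) (use * ** in \<open>simp_all add: word_Nil word_Cons eq\<close>)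
  then show "\<phi> = \<phi>'"
    using * ** End_k_ext by blast
qed

lemma ex1_partial_op:
  assumes "\<psi> \<in> End_k"
  shows "\<exists>!\<phi>. \<phi> \<in> End_k \<and> comm \<phi> (X i) = left_act a \<psi> \<and>
    (\<forall>l. l \<noteq> i \<longrightarrow> comm \<phi> (X l) = (\<lambda>_. 0)) \<and> \<phi> 1 = 0"
proof -
  have "(if j = i then left_act a \<psi> else (\<lambda>_. 0)) \<in> End_k" for j
    using assms by (auto simp: End_k_iff left_act_def distrib_left scale_mult_right)
      (simp add: scale_def)
  from ex1_comm[of "\<lambda>j. if j = i then left_act a \<psi> else (\<lambda>_. 0)", OF this]
  show ?thesis
    by (rule back_subst[of Ex1]) auto
qed

lemma derivation_iff_comm:
  "is_derivation d \<and> (\<forall>j. d (X j) = (if i = j then a else 0)) \<longleftrightarrow>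
    d \<in> End_k \<and> (\<forall>j. comm d (X j) = lmul (if i = j then a else 0)) \<and> d 1 = 0"
  (is "?L \<longleftrightarrow> ?R")
proof
  assume ?L
  then have "d (1 * 1) = d 1 * 1 + 1 * d 1"
    unfolding is_derivation_def by blast
  then have "d 1 = 0" by simp
  with \<open>?L\<close> show ?R
    by (auto simp: is_derivation_def comm_def left_act_def right_act_def lmul_def)
next
  assume R: ?R
  have eq: "d (X j * s) = (if i = j then a else 0) * s + X j * d s" for j s
    using fun_cong[OF R[THEN conjunct2, THEN conjunct1, rule_format], of j s]
    by (simp add: comm_def left_act_def right_act_def lmul_def diff_eq_eq)
  have X: "d (X j) = (if i = j then a else 0)" for j
    using eq[of j 1] R by simp
  have word: "d (word w * q) = d (word w) * q + word w * d q" for w q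
    by (induction w) (use R in \<open>simp_all add: word_Nil word_Cons eq mult.assoc algebra_simps\<close>)
  have "d (p * q) = d p * q + p * d q" for p q
  proof (induction p rule: free_alg_induct)
    case zero
    show ?case using R by (simp add: End_k_zero)
  next
    case (step p c w)
    have "d (scale c (word w) * q) = d (scale c (word w)) * q + scale c (word w) * d q"
      using R by (simp add: End_k_iff scale_mult_left word) (simp add: scale_def distrib_left)
    with step R show ?case
      by (simp add: End_k_iff distrib_right)
  qed
  with R X show ?L by (simp add: is_derivation_def)
qed

lemma ex1_partial_deriv:
  "\<exists>!d. is_derivation d \<and> (\<forall>j. d (X j) = (if i = j then a else 0))"
  unfolding derivation_iff_comm
  by (rule ex1_comm) (simp add: End_k_iff lmul_def distrib_left scale_mult_right)

lemma partial_op_End_k: "partial_op I J \<in> End_k"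
proof (induction I J rule: partial_op.induct)
  case (1 i a)
  from theI'[OF ex1_partial_deriv[of i a]] show ?case
    by (simp add: partial_deriv_def is_derivation_def)
next
  case (2 i i' I a a' J)
  from theI'[OF ex1_partial_op[OF 2, of i a]] show ?case
    by simp
qed (simp_all add: End_k_iff scale_def)

section \<open>Pointwise finite series\<close>

text \<open>
  \<open>series_terms \<alpha> s\<close> indexes the nonzero terms of the series at \<open>s\<close>. Its finiteness is demanded
  explicitly because \<open>sum\<close> is \<open>0\<close> over an infinite index set. Values \<open>\<alpha> [] w\<close> never enter.
\<close>

definition series_terms :: "('x list \<Rightarrow> 'x list \<Rightarrow> 'k::field) \<Rightarrow>
    ('x, 'k) free_alg \<Rightarrow> ('x list \<times> 'x list) set"
  where "series_terms \<alpha> s =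
    {(I, w). I \<noteq> [] \<and> scale (\<alpha> I w) (partial_op I (word_seq w I) s) \<noteq> 0}"

definition expands_as :: "(('x, 'k::field) free_alg \<Rightarrow> ('x, 'k) free_alg) \<Rightarrow>
    ('x, 'k) free_alg \<Rightarrow> ('x list \<Rightarrow> 'x list \<Rightarrow> 'k) \<Rightarrow> bool"
  where "expands_as \<phi> a \<alpha> \<longleftrightarrow>
    (\<forall>I. I \<noteq> [] \<longrightarrow> finite {w. \<alpha> I w \<noteq> 0}) \<and>
    (\<forall>s. finite (series_terms \<alpha> s) \<and>
      \<phi> s = lmul a s +
        (\<Sum>(I, w)\<in>series_terms \<alpha> s. scale (\<alpha> I w) (partial_op I (word_seq w I) s)))"

end

theory Submission
  imports Defs
begin

text \<open>
  Differential operators are linear (lemma \<open>Diff_subset_End_k\<close>), so each is determined by its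
  values on the words. These values can be matched word by word because the family of operators
  \<open>\<partial>\<^sub>I\<^sup>J\<close> is triangular with respect to word length: on words no longer than \<open>I\<close>,
  \<open>\<partial>\<^sub>I\<^sup>J\<close> vanishes except on the word \<open>I\<close> itself, which it sends to the product of the entries of
  \<open>J\<close> (lemma \<open>partial_op_word\<close>). For \<open>J = w\<^sub>I\<close> that product is \<open>w\<close>.

  Group the terms of the series with the same \<open>I\<close>, and let \<open>c I = (\<Sum>w. \<alpha>\<^sub>I\<^sub>,\<^sub>w w)\<close>, an element of the
  algebra. Evaluating the series at \<open>1\<close> gives \<open>a\<close>; evaluating it at a nonempty word \<open>u\<close> gives
  \<open>a u\<close>, a contribution of the finitely many sequences shorter than \<open>u\<close>, and \<open>c u\<close>. Hence the series
  represents \<open>\<phi>\<close> exactly if \<open>a = \<phi> 1\<close> and the \<open>c u\<close> satisfy a recursion on the length of \<open>u\<close>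
  (lemma \<open>expands_as_iff\<close>). A recursion has exactly one solution.
\<close>

section \<open>Linear operators\<close>

lemma End_k_add: "\<phi> \<in> End_k \<Longrightarrow> \<psi> \<in> End_k \<Longrightarrow> (\<lambda>s. \<phi> s + \<psi> s) \<in> End_k"
  by (simp add: End_k_iff) (simp add: scale_def algebra_simps)

lemma End_k_lmul: "lmul a \<in> End_k"
  by (simp add: End_k_iff lmul_def distrib_left scale_mult_right)

lemma End_k_scale:
  assumes "\<phi> \<in> End_k"
  shows "(\<lambda>s. scale c (\<phi> s)) \<in> End_k"
  using assms by (auto simp: End_k_iff intro!: poly_mapping_eqI)
    (simp_all add: lookup_scale lookup_add algebra_simps)

lemma End_k_sum:
  assumes "\<And>i. i \<in> A \<Longrightarrow> f i \<in> End_k"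
  shows "(\<lambda>s. \<Sum>i\<in>A. f i s) \<in> End_k"
  using assms
proof (induction A rule: infinite_finite_induct)
  case (insert i A)
  then show ?case
    using End_k_add[of "f i" "\<lambda>s. \<Sum>i\<in>A. f i s"] by simp
qed (simp_all add: End_k_iff scale_def)

lemma End_k_eq_on_keys:
  assumes "\<phi> \<in> End_k" "\<psi> \<in> End_k"
    and "\<And>u. u \<in> Poly_Mapping.keys s \<Longrightarrow> \<phi> (word u) = \<psi> (word u)"
  shows "\<phi> s = \<psi> s"
proof -
  have rep: "\<chi> = lin_ext (\<lambda>u. \<chi> (word u))" if "\<chi> \<in> End_k" for \<chi> :: "('a, 'b) free_alg \<Rightarrow> _"
    using that by (intro End_k_ext lin_ext_End_k) (simp_all add: lin_ext_word)
  have "\<phi> s = lin_ext (\<lambda>u. \<phi> (word u)) s"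
    by (rule fun_cong[OF rep[OF assms(1)]])
  also have "\<dots> = lin_ext (\<lambda>u. \<psi> (word u)) s"
    using assms(3) by (simp add: lin_ext_def)
  also have "\<dots> = \<psi> s"
    by (rule fun_cong[OF rep[OF assms(2), symmetric]])
  finally show ?thesis .
qed

lemma subbimodule_End_k: "subbimodule End_k"
  unfolding subbimodule_def
  by (auto simp: End_k_iff left_act_def right_act_def distrib_left scale_mult_right)
    (simp_all add: scale_def algebra_simps)

lemma Diff_subset_End_k: "Diff \<subseteq> End_k"
proof -
  have "diff_ops m \<subseteq> End_k" for m
    by (cases m) (simp_all only: diff_ops.simps, (intro hull_minimal[where S = subbimodule]
        subbimodule_End_k Collect_restrict)+)
  then show ?thesis
    unfolding Diff_def by blast
qed

section \<open>The operators on short words\<close>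

lemma partial_deriv_step:
  "partial_deriv i a 1 = 0"
  "partial_deriv i a (X j * s) = (if j = i then a * s else 0) + X j * partial_deriv i a s"
proof -
  have *: "is_derivation (partial_deriv i a) \<and>
      (\<forall>j. partial_deriv i a (X j) = (if i = j then a else 0))"
    unfolding partial_deriv_def by (rule theI'[OF ex1_partial_deriv])
  then show "partial_deriv i a 1 = 0"
    unfolding derivation_iff_comm by blast
  from * show "partial_deriv i a (X j * s) =
      (if j = i then a * s else 0) + X j * partial_deriv i a s"
    by (auto simp: is_derivation_def)
qed

lemma partial_op_step:
  "partial_op (i # i' # I) (a # a' # J) 1 = 0"
  "partial_op (i # i' # I) (a # a' # J) (X j * s) =
    (if j = i then a * partial_op (i' # I) (a' # J) s else 0) +
    X j * partial_op (i # i' # I) (a # a' # J) s"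
proof -
  let ?\<phi> = "partial_op (i # i' # I) (a # a' # J)"
  have *: "?\<phi> \<in> End_k \<and> comm ?\<phi> (X i) = left_act a (partial_op (i' # I) (a' # J)) \<and>
      (\<forall>l. l \<noteq> i \<longrightarrow> comm ?\<phi> (X l) = (\<lambda>_. 0)) \<and> ?\<phi> 1 = 0"
    using theI'[OF ex1_partial_op[OF partial_op_End_k[of "i' # I" "a' # J"], of i a]] by simp
  then show "?\<phi> 1 = 0"
    by blast
  have "comm ?\<phi> (X j) s = (if j = i then a * partial_op (i' # I) (a' # J) s else 0)"
    using * by (simp add: left_act_def)
  then show "?\<phi> (X j * s) = (if j = i then a * partial_op (i' # I) (a' # J) s else 0) + X j * ?\<phi> s"
    by (simp add: comm_def left_act_def right_act_def diff_eq_eq)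
qed

text \<open>
  On an arbitrary word \<open>u\<close>, \<open>\<partial>\<^sub>I\<^sup>J\<close> sums over the embeddings of \<open>I\<close> into \<open>u\<close> as a subword, replacing
  each chosen letter by the corresponding entry of \<open>J\<close>. If \<open>u\<close> is no longer than \<open>I\<close>, the only
  possible embedding is the identity.
\<close>

lemma partial_op_word:
  assumes "I \<noteq> []" "length J = length I" "length u \<le> length I"
  shows "partial_op I J (word u) = (if u = I then prod_list J else 0)"
  using assms
proof (induction u arbitrary: I J)
  case Nil
  then show ?case
    by (cases "(I, J)" rule: partial_op.cases)
      (auto simp: word_Nil partial_deriv_step partial_op_step simp del: partial_op.simps(2))
next
  case (Cons j u)
  have tail: "partial_op I J (word u) = 0"
    using Cons.IH[of I J] Cons.prems by auto
  show ?case
  proof (cases "(I, J)" rule: partial_op.cases)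
    case (1 i a)
    then show ?thesis
      using Cons.prems tail partial_deriv_step(2)[of i a j 1] partial_deriv_step(1)[of i a]
      by (auto simp: word_Cons word_Nil)
  next
    case (2 i i' I' a a' J')
    then have "partial_op (i' # I') (a' # J') (word u) =
        (if u = i' # I' then prod_list (a' # J') else 0)"
      using Cons.prems by (intro Cons.IH) auto
    with 2 tail show ?thesis
      by (auto simp: word_Cons partial_op_step simp del: partial_op.simps(2))
  qed (use Cons.prems in auto)
qed

lemma partial_op_word_seq:
  assumes "I \<noteq> []" "length u \<le> length I"
  shows "partial_op I (word_seq w I) (word u) = (if u = I then word w else 0)"
proof -
  have "prod_list (word_seq w I :: ('a, 'b) free_alg list) = word w"
    by (simp add: word_seq_def prod_list_replicate)
  with assms show ?thesis
    by (subst partial_op_word) (auto simp: word_seq_def Suc_le_eq)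
qed

section \<open>Grouping the series by the index sequence\<close>

text \<open>
  For \<open>q = (\<Sum>w. \<alpha>\<^sub>w w)\<close> this is \<open>(\<Sum>w. \<alpha>\<^sub>w \<partial>\<^sub>I\<^bsup>w\<^sub>I\<^esup>)\<close>: the coefficients belonging to one \<open>I\<close> are
  collected in a single element of the algebra, which has finite support by construction.
\<close>

definition seq_op :: "('x, 'k::field) free_alg \<Rightarrow> 'x list \<Rightarrow> ('x, 'k) free_alg \<Rightarrow> ('x, 'k) free_alg"
  where "seq_op q I s = lin_ext (\<lambda>w. partial_op I (word_seq w I) s) q"

lemma seq_op_End_k: "seq_op q I \<in> End_k"
proof -
  have "(\<lambda>s. \<Sum>w\<in>Poly_Mapping.keys q. scale (Poly_Mapping.lookup q w)
      (partial_op I (word_seq w I) s)) \<in> End_k"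
    by (intro End_k_sum End_k_scale partial_op_End_k)
  then show ?thesis
    by (simp add: seq_op_def[abs_def] lin_ext_def)
qed

lemma lin_ext_word_id: "lin_ext word q = q"
proof -
  have "lin_ext word = (\<lambda>p. p :: ('a, 'b) free_alg)"
    by (rule End_k_ext[OF lin_ext_End_k]) (simp_all add: End_k_iff lin_ext_word)
  then show ?thesis
    by simp
qed

lemma seq_op_word:
  assumes "I \<noteq> []" "length u \<le> length I"
  shows "seq_op q I (word u) = (if u = I then q else 0)"
proof (cases "u = I")
  case True
  with assms show ?thesis
    by (simp add: seq_op_def partial_op_word_seq lin_ext_word_id[unfolded lin_ext_def] lin_ext_def)
next
  case False
  with assms show ?thesis
    by (simp add: seq_op_def partial_op_word_seq lin_ext_def scale_def)
qed

lemma finite_seqs: "finite {I :: 'x::finite list. I \<noteq> [] \<and> length I \<le> N}"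
  by (rule finite_subset[OF _ finite_lists_length_le[of UNIV N]]) auto

text \<open>
  Since \<open>\<partial>\<^sub>I\<^sup>J\<close> kills words shorter than \<open>I\<close>, only the sequences of length at most \<open>N\<close> act on an element
  supported on words of length at most \<open>N\<close>; there are finitely many of them because there are finitely
  many variables.
\<close>

lemma series_truncation:
  fixes c :: "'x::finite list \<Rightarrow> ('x, 'k::field) free_alg"
  assumes \<alpha>: "\<And>I. I \<noteq> [] \<Longrightarrow> \<alpha> I = Poly_Mapping.lookup (c I)"
    and N: "\<And>u. u \<in> Poly_Mapping.keys s \<Longrightarrow> length u \<le> N"
  shows "finite (series_terms \<alpha> s)"
    and "(\<Sum>(I, w)\<in>series_terms \<alpha> s. scale (\<alpha> I w) (partial_op I (word_seq w I) s)) =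
      (\<Sum>I | I \<noteq> [] \<and> length I \<le> N. seq_op (c I) I s)"
proof -
  let ?S = "{I :: 'x list. I \<noteq> [] \<and> length I \<le> N}"
  let ?B = "SIGMA I : ?S. Poly_Mapping.keys (c I)"
  have short: "length I \<le> N" if "I \<noteq> []" "partial_op I (word_seq w I) s \<noteq> 0" for I w
  proof (rule ccontr)
    assume "\<not> length I \<le> N"
    then have "partial_op I (word_seq w I) (word u) = 0" if "u \<in> Poly_Mapping.keys s" for u
      using N[OF that] \<open>I \<noteq> []\<close> by (subst partial_op_word_seq) auto
    then have "partial_op I (word_seq w I) s = (\<lambda>_. 0) s"
      by (rule End_k_eq_on_keys[OF partial_op_End_k, rotated]) (simp_all add: End_k_iff scale_def)
    with that show False by simp
  qed
  have finB: "finite ?B"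
    by (intro finite_SigmaI finite_seqs) simp
  have sub: "series_terms \<alpha> s \<subseteq> ?B"
  proof (rule subrelI, unfold mem_Sigma_iff)
    fix I w assume "(I, w) \<in> series_terms \<alpha> s"
    then have "I \<noteq> []" and nz: "scale (\<alpha> I w) (partial_op I (word_seq w I) s) \<noteq> 0"
      by (auto simp: series_terms_def)
    moreover from nz have "partial_op I (word_seq w I) s \<noteq> 0" "\<alpha> I w \<noteq> 0"
      by (auto simp: scale_def)
    ultimately show "I \<in> ?S \<and> w \<in> Poly_Mapping.keys (c I)"
      using short[of I w] \<alpha>[of I] by (simp add: in_keys_iff)
  qed
  with finB show "finite (series_terms \<alpha> s)"
    by (rule finite_subset[rotated])
  have "(\<Sum>(I, w)\<in>series_terms \<alpha> s. scale (\<alpha> I w) (partial_op I (word_seq w I) s)) =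
      (\<Sum>(I, w)\<in>?B. scale (\<alpha> I w) (partial_op I (word_seq w I) s))"
    using sub finB by (intro sum.mono_neutral_left) (auto simp: series_terms_def)
  also have "\<dots> = (\<Sum>I\<in>?S. \<Sum>w\<in>Poly_Mapping.keys (c I).
      scale (\<alpha> I w) (partial_op I (word_seq w I) s))"
    by (rule sum.Sigma[symmetric]) (auto intro: finite_seqs)
  also have "\<dots> = (\<Sum>I\<in>?S. seq_op (c I) I s)"
    by (intro sum.cong) (auto simp: seq_op_def lin_ext_def \<alpha>)
  finally show "(\<Sum>(I, w)\<in>series_terms \<alpha> s. scale (\<alpha> I w) (partial_op I (word_seq w I) s)) =
      (\<Sum>I\<in>?S. seq_op (c I) I s)" .
qed

section \<open>The triangular system for the coefficients\<close>

definition lower_part :: "('x list \<Rightarrow> ('x, 'k::field) free_alg) \<Rightarrow> 'x list \<Rightarrow> ('x, 'k) free_alg"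
  where "lower_part c u = (\<Sum>I | I \<noteq> [] \<and> length I < length u. seq_op (c I) I (word u))"

lemma truncated_series_word:
  fixes c :: "'x::finite list \<Rightarrow> ('x, 'k::field) free_alg"
  assumes "u \<noteq> []" "length u \<le> N"
  shows "(\<Sum>I | I \<noteq> [] \<and> length I \<le> N. seq_op (c I) I (word u)) = lower_part c u + c u"
proof -
  let ?L = "{I :: 'x list. I \<noteq> [] \<and> length I < length u}"
  have fin: "finite ?L"
    by (rule finite_subset[OF _ finite_seqs[of "length u"]]) auto
  have "(\<Sum>I | I \<noteq> [] \<and> length I \<le> N. seq_op (c I) I (word u)) =
      (\<Sum>I\<in>insert u ?L. seq_op (c I) I (word u))"
    using assms by (intro sum.mono_neutral_right finite_seqs)
      (auto simp: seq_op_word not_le intro: ccontr[of "_ < _"])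
  also have "\<dots> = lower_part c u + c u"
    using fin assms by (simp add: lower_part_def seq_op_word add.commute)
  finally show ?thesis .
qed

lemma expands_as_iff:
  fixes c :: "'x::finite list \<Rightarrow> ('x, 'k::field) free_alg"
  assumes \<phi>: "\<phi> \<in> End_k" and \<alpha>: "\<And>I. I \<noteq> [] \<Longrightarrow> \<alpha> I = Poly_Mapping.lookup (c I)"
  shows "expands_as \<phi> a \<alpha> \<longleftrightarrow>
    \<phi> 1 = a \<and> (\<forall>u. u \<noteq> [] \<longrightarrow> \<phi> (word u) = a * word u + (lower_part c u + c u))"
    (is "_ \<longleftrightarrow> ?R")
proof -
  let ?T = "\<lambda>N s. \<Sum>I | I \<noteq> [] \<and> length I \<le> N. seq_op (c I) I s"
  note trunc = series_truncation[of \<alpha> c, OF \<alpha>]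
  have keys_word: "Poly_Mapping.keys (word u :: ('x, 'k) free_alg) = {u}" for u
    by (simp add: word_def)
  have zero: "?T N 1 = 0" for N
    by (auto intro!: sum.neutral simp: seq_op_word simp flip: word_Nil)
  show ?thesis
  proof
    assume *: "expands_as \<phi> a \<alpha>"
    have "\<phi> s = a * s + ?T N s" if "\<And>u. u \<in> Poly_Mapping.keys s \<Longrightarrow> length u \<le> N" for N s
      using * that by (simp add: expands_as_def lmul_def trunc(2))
    from this[of "word u" "length u" for u] have
      "\<phi> (word u) = a * word u + ?T (length u) (word u)" for u
      by (simp add: keys_word)
    from this this[of "[]"] show ?R
      by (auto simp: truncated_series_word word_Nil zero simp del: list.size)
  next
    assume R: ?R
    have "\<phi> s = lmul a s +
        (\<Sum>(I, w)\<in>series_terms \<alpha> s. scale (\<alpha> I w) (partial_op I (word_seq w I) s))"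
      and "finite (series_terms \<alpha> s)" for s
    proof -
      define N where "N = Max (length ` Poly_Mapping.keys s)"
      have N: "length u \<le> N" if "u \<in> Poly_Mapping.keys s" for u
        using that by (simp add: N_def)
      show "finite (series_terms \<alpha> s)"
        by (rule trunc(1)[OF _ N]) simp_all
      have "\<phi> s = (\<lambda>s. lmul a s + ?T N s) s"
      proof (rule End_k_eq_on_keys[OF \<phi>])
        show "(\<lambda>s. lmul a s + ?T N s) \<in> End_k"
          by (intro End_k_add End_k_lmul End_k_sum seq_op_End_k)
        fix u assume "u \<in> Poly_Mapping.keys s"
        with R show "\<phi> (word u) = lmul a (word u) + ?T N (word u)"
          by (cases "u = []") (auto simp: N lmul_def word_Nil zero truncated_series_word)
      qed
      then show "\<phi> s = lmul a s +
          (\<Sum>(I, w)\<in>series_terms \<alpha> s. scale (\<alpha> I w) (partial_op I (word_seq w I) s))"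
        by (simp add: trunc(2)[OF _ N])
    qed
    then show "expands_as \<phi> a \<alpha>"
      unfolding expands_as_def by (simp add: \<alpha>)
  qed
qed

text \<open>
  The solution of the system. The recursion inlines \<open>lower_part\<close>, so that the termination proof sees
  that only shorter sequences occur.
\<close>

function coeffs :: "(('x, 'k::field) free_alg \<Rightarrow> ('x, 'k) free_alg) \<Rightarrow> 'x list \<Rightarrow> ('x, 'k) free_alg"
  where "coeffs \<phi> u = \<phi> (word u) - \<phi> 1 * word u -
    (\<Sum>I | I \<noteq> [] \<and> length I < length u. seq_op (coeffs \<phi> I) I (word u))"
  by pat_completeness auto
termination
  by (relation "measure (\<lambda>(\<phi>, u). length u)") auto

declare coeffs.simps [simp del]

theorem mainTheorem2:
  fixes \<phi> :: "('x::finite, 'k::field) free_alg \<Rightarrow> ('x, 'k) free_alg"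
  assumes "CARD('x) > 1"
    and "\<phi> \<in> Diff"
  shows "\<exists>a \<alpha>. expands_as \<phi> a \<alpha> \<and>
    (\<forall>b \<beta>. expands_as \<phi> b \<beta> \<longrightarrow> b = a \<and> (\<forall>I w. I \<noteq> [] \<longrightarrow> \<beta> I w = \<alpha> I w))"
proof (intro exI conjI allI impI)
  have \<phi>: "\<phi> \<in> End_k"
    using assms(2) Diff_subset_End_k by blast
  have coeffs: "coeffs \<phi> u = \<phi> (word u) - \<phi> 1 * word u - lower_part (coeffs \<phi>) u" for u
    unfolding lower_part_def by (rule coeffs.simps)
  then have "\<phi> (word u) = \<phi> 1 * word u + (lower_part (coeffs \<phi>) u + coeffs \<phi> u)" for u
    by (metis add_diff_cancel_left' add.commute diff_add_cancel)
  then show "expands_as \<phi> (\<phi> 1) (\<lambda>I. Poly_Mapping.lookup (coeffs \<phi> I))"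
    by (simp add: expands_as_iff[OF \<phi>, of _ "coeffs \<phi>"])
  fix b \<beta> assume \<beta>: "expands_as \<phi> b \<beta>"
  define c where "c I = Abs_poly_mapping (\<beta> I)" for I
  have c: "\<beta> I = Poly_Mapping.lookup (c I)" if "I \<noteq> []" for I
    using \<beta> that by (simp add: expands_as_def c_def)
  from \<beta> have b: "\<phi> 1 = b"
    by (simp add: expands_as_iff[OF \<phi> c])
  from \<beta> have rec: "\<phi> (word u) = b * word u + (lower_part c u + c u)" if "u \<noteq> []" for u
    using that by (auto simp: expands_as_iff[OF \<phi> c])
  show "b = \<phi> 1"
    using b by simp
  have eq: "c u = coeffs \<phi> u" if "u \<noteq> []" for u
    using that
  proof (induction u rule: length_induct)
    case (1 u)
    then have "lower_part c u = lower_part (coeffs \<phi>) u"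
      by (auto simp: lower_part_def intro!: sum.cong)
    with rec[OF 1(2)] b show ?case
      by (simp add: coeffs[of u])
  qed
  show "\<beta> I w = Poly_Mapping.lookup (coeffs \<phi> I) w" if "I \<noteq> []" for I w
    using c eq that by simp
qed

end
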